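(* With fixed parameters $q$ and $T$, HP1 performs better than HP2 in terms of average order delay. That is, letting $AOD_{HP1}$ and $AOD_{HP2}$ denote the average order delays of HP1 and HP2, both with parameters $(q,T)$, $$AOD_{HP1}<AOD_{HP2}.$$
   Context: Customer orders arrive according to a Poisson process $\{N(t)\}_{t\ge 0}$ with rate $\lambda>0$ and $N(0)=0$; $\tau_n$ denotes the arrival time of the $n$-th order, and $a\wedge b=\min(a,b)$. A renewal-type clearing policy is specified by its shipment-release time $\tau$ (the length of one consolidation cycle started at time $0$), a stopping time of the natural filtration of $N$ with $0<\mathbb{E}[\tau]<\infty$. Its average order delay is $AOD_\tau=\mathbb{E}\left[\int_0^\tau N(u)\,du\right]/(\lambda\,\mathbb{E}[\tau])$; a policy performs better than another in terms of average order delay if its average order delay is smaller. The policies, with parameters $q$ (an integer, $q\ge1$) and $T>0$, are: HP1: $\tau=\tau_q\wedge T$; HP2: $\tau=\tau_q\wedge(\tau_1+T)$.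
   Formalization: The formal statement assumes q ≥ 2 instead of q ≥ 1: for q = 1 no order is waiting before the first arrival, so both average order delays equal 0 and the strict inequality fails. *)

theory Defs
  imports "HOL-Probability.Probability"
begin

text \<open>
  Only times \<open>t \<ge> 0\<close> matter. The path properties hold for every outcome (not merely almost
  surely), as for any process that counts arrivals; no completeness of \<open>M\<close> is needed to make
  the arrival times measurable. Monotonicity makes the truncated subtraction of naturals in the
  increments the true one.
\<close>

locale poisson_process = prob_space M
  for M :: "'a measure" and N :: "real \<Rightarrow> 'a \<Rightarrow> nat" and rate :: real +
  assumes rate_pos: "0 < rate"
    and measurable_count: "\<And>t. 0 \<le> t \<Longrightarrow> N t \<in> M \<rightarrow>\<^sub>M count_space UNIV"
    and count_zero: "\<And>\<omega>. \<omega> \<in> space M \<Longrightarrow> N 0 \<omega> = 0"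
    and count_mono: "\<And>\<omega> s t. \<omega> \<in> space M \<Longrightarrow> 0 \<le> s \<Longrightarrow> s \<le> t \<Longrightarrow> N s \<omega> \<le> N t \<omega>"
    and right_continuous:
      "\<And>\<omega> t. \<omega> \<in> space M \<Longrightarrow> 0 \<le> t \<Longrightarrow> continuous (at_right t) (\<lambda>u. N u \<omega>)"
    and poisson_increments:
      "\<And>s t. 0 \<le> s \<Longrightarrow> s < t \<Longrightarrow>
         distr M (count_space UNIV) (\<lambda>\<omega>. N t \<omega> - N s \<omega>)
           = measure_pmf (poisson_pmf (rate * (t - s)))"
    and independent_increments:
      "\<And>(n::nat) (t :: nat \<Rightarrow> real). 0 \<le> t 0 \<Longrightarrow> (\<And>i. i < n \<Longrightarrow> t i < t (Suc i)) \<Longrightarrow>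
         indep_vars (\<lambda>_. count_space UNIV) (\<lambda>i \<omega>. N (t (Suc i)) \<omega> - N (t i) \<omega>) {..<n}"

text \<open>The value is \<open>\<infinity>\<close> on the (null) event that fewer than \<open>n\<close> orders ever arrive.\<close>

definition arrival_time :: "(real \<Rightarrow> 'a \<Rightarrow> nat) \<Rightarrow> nat \<Rightarrow> 'a \<Rightarrow> ennreal" where
  "arrival_time N n \<omega> = (INF t \<in> {t. 0 \<le> t \<and> n \<le> N t \<omega>}. ennreal t)"

definition HP1 :: "(real \<Rightarrow> 'a \<Rightarrow> nat) \<Rightarrow> nat \<Rightarrow> real \<Rightarrow> 'a \<Rightarrow> ennreal" where
  "HP1 N q T \<omega> = min (arrival_time N q \<omega>) (ennreal T)"

definition HP2 :: "(real \<Rightarrow> 'a \<Rightarrow> nat) \<Rightarrow> nat \<Rightarrow> real \<Rightarrow> 'a \<Rightarrow> ennreal" where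
  "HP2 N q T \<omega> = min (arrival_time N q \<omega>) (arrival_time N 1 \<omega> + ennreal T)"

text \<open>
  Both expectations are of nonnegative random variables, so they are taken in \<open>[0, \<infinity>]\<close>; no
  integrability convention enters.
\<close>

definition average_order_delay ::
    "'a measure \<Rightarrow> (real \<Rightarrow> 'a \<Rightarrow> nat) \<Rightarrow> real \<Rightarrow> ('a \<Rightarrow> ennreal) \<Rightarrow> ennreal" where
  "average_order_delay M N rate \<tau> =
     (\<integral>\<^sup>+\<omega>. (\<integral>\<^sup>+u\<in>{u. 0 \<le> u \<and> ennreal u \<le> \<tau> \<omega>}. of_nat (N u \<omega>) \<partial>lborel) \<partial>M)
       / (ennreal rate * (\<integral>\<^sup>+\<omega>. \<tau> \<omega> \<partial>M))"

end

theory Submission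
  imports Defs
begin

text \<open>
  By Tonelli, the expected area under \<open>N\<close> during a cycle is the sum over \<open>k\<close> of \<open>k\<close> times the
  expected time that the cycle spends at level \<open>k\<close>, and the expected cycle length is the sum of
  these times. So, up to the factor \<open>1 / rate\<close>, the average order delay is the mean of the level
  under the distribution proportional to the expected time at each level \<open>k < q\<close>.

  Write \<open>p\<^sub>k(u)\<close> for the Poisson probability of \<open>k\<close> orders by time \<open>u\<close>. Apart from a null set of
  times, HP1 is running at time \<open>u\<close> iff \<open>N(u) < q\<close> and \<open>u \<le> T\<close>, so it spends the expected time
  \<open>a\<^sub>k = \<integral>\<^sub>0\<^sup>T p\<^sub>k(u) du\<close> at level \<open>k\<close> (\<open>HP1_levels\<close>). HP2 is running at time \<open>u\<close> iff \<open>N(u) < q\<close> and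
  no order had arrived by time \<open>u - T\<close>, that is, \<open>N(u - T) = 0\<close> with \<open>u - T\<close> replaced by \<open>0\<close> when it is
  negative. Up to time \<open>T\<close> this gives \<open>a\<^sub>k\<close> again. After \<open>T\<close>, independence of the increments on
  \<open>[0, u - T]\<close> and \<open>[u - T, u]\<close> contributes \<open>\<integral>\<^sub>T\<^sup>\<infinity> exp(- rate (u - T)) p\<^sub>k(T) du = p\<^sub>k(T) / rate\<close>
  (\<open>HP2_levels\<close>). HP2 is described at fixed times because the independence hypothesis speaks of
  deterministic intervals; restarting the process at the random time \<open>\<tau>\<^sub>1\<close> would call for the strong
  Markov property.

  Normalised on \<open>k < q\<close>, the level distribution of HP2 is thus a mixture of the one given by \<open>(a\<^sub>k)\<close>
  and the one given by \<open>(p\<^sub>k(T))\<close>, and it remains to see that the latter has the larger mean. Poisson distributions are ordered by likelihood ratio in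
  their parameter: \<open>p\<^sub>k(u) / p\<^sub>k(T)\<close> is proportional to \<open>(u / T)\<^sup>k\<close>, strictly decreasing in \<open>k\<close> for
  \<open>0 < u < T\<close>. Integrating over \<open>u\<close>, so is \<open>a\<^sub>k / p\<^sub>k(T)\<close> (\<open>integral_poisson_weight_ratio\<close>), and a
  likelihood ratio order implies the order of the means (\<open>ratio_mean_less\<close>).
\<close>

section \<open>Likelihood ratio order and truncated Poisson means\<close>

text \<open>
  Clearing denominators, the difference of the two sides has the sign of
  \<open>S = \<Sum>\<^sub>j\<^sub>k k (a\<^sub>j b\<^sub>k - a\<^sub>k b\<^sub>j)\<close>. The bracket is antisymmetric in \<open>(j, k)\<close>, so swapping the indices
  and averaging replaces the factor \<open>k\<close> by \<open>(k - j) / 2\<close>; then every term is nonnegative by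
  the likelihood ratio hypothesis, and the term \<open>(0, 1)\<close> is positive.
\<close>

lemma ratio_mean_less:
  fixes a b :: "nat \<Rightarrow> real"
  assumes "2 \<le> q"
    and a: "\<And>k. 0 < a k" and b: "\<And>k. 0 < b k"
    and mlr: "\<And>j k. j < k \<Longrightarrow> a k * b j < a j * b k"
  shows "(\<Sum>k<q. real k * a k) / (\<Sum>k<q. a k)
       < (\<Sum>k<q. real k * (a k + b k)) / (\<Sum>k<q. a k + b k)"
proof -
  define D where "D j k = a j * b k - a k * b j" for j k
  define S where "S = (\<Sum>j<q. \<Sum>k<q. real k * D j k)"
  have "S = (\<Sum>k<q. \<Sum>j<q. real k * D j k)"
    unfolding S_def by (rule sum.swap)
  also have "\<dots> = - (\<Sum>j<q. \<Sum>k<q. real j * D j k)"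
    by (simp add: D_def algebra_simps sum_subtractf)
  finally have "2 * S = (\<Sum>j<q. \<Sum>k<q. (real k - real j) * D j k)"
    by (simp add: S_def left_diff_distrib sum_subtractf)
  also have "\<dots> > 0"
  proof -
    have nonneg: "0 \<le> (real k - real j) * D j k" for j k
      using mlr[of j k] mlr[of k j]
      by (cases j k rule: linorder_cases) (auto simp: D_def zero_le_mult_iff)
    have "0 < (real 1 - real 0) * D 0 1"
      using mlr[of 0 1] by (simp add: D_def)
    also have "\<dots> \<le> (\<Sum>k<q. (real k - real 0) * D 0 k)"
      using \<open>2 \<le> q\<close> nonneg[of _ 0] by (intro member_le_sum) auto
    also have "\<dots> \<le> (\<Sum>j<q. \<Sum>k<q. (real k - real j) * D j k)"
      using \<open>2 \<le> q\<close> nonneg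
      by (intro member_le_sum[of 0 "{..<q}" "\<lambda>j. \<Sum>k<q. (real k - real j) * D j k"])
         (auto intro!: sum_nonneg)
    finally show ?thesis .
  qed
  finally have "0 < S" by simp
  also have "S = (\<Sum>k<q. real k * b k) * (\<Sum>k<q. a k) - (\<Sum>k<q. real k * a k) * (\<Sum>k<q. b k)"
  proof -
    have "S = (\<Sum>j<q. \<Sum>k<q. a j * (real k * b k)) - (\<Sum>j<q. \<Sum>k<q. b j * (real k * a k))"
      by (simp add: S_def D_def algebra_simps sum_subtractf)
    then show ?thesis
      by (simp flip: sum_product add: mult.commute)
  qed
  finally have "(\<Sum>k<q. real k * a k) * (\<Sum>k<q. b k) < (\<Sum>k<q. real k * b k) * (\<Sum>k<q. a k)"
    by simp
  moreover have "0 < (\<Sum>k<q. a k)" "0 < (\<Sum>k<q. b k)"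
    using assms by (auto intro!: sum_pos simp: lessThan_empty_iff)
  ultimately show ?thesis
    by (simp add: sum.distrib distrib_left divide_simps algebra_simps)
qed

text \<open>
  This is the Poisson probability mass at \<open>k\<close>, as an explicit formula so that it also covers \<open>x = 0\<close>
  (\<open>pmf_poisson\<close> speaks of positive parameters only) and is continuous on all of \<open>\<real>\<close>.
\<close>
definition poisson_weight :: "real \<Rightarrow> nat \<Rightarrow> real" where
  "poisson_weight x k = x ^ k / fact k * exp (- x)"

lemma continuous_on_poisson_weight: "continuous_on A (\<lambda>u. poisson_weight (c * u) k)"
  unfolding poisson_weight_def by (intro continuous_intros) auto

lemma nn_integral_poisson_weight:
  assumes "0 \<le> c"
  shows "(\<integral>\<^sup>+u\<in>{0..T}. ennreal (poisson_weight (c * u) k) \<partial>lborel)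
       = ennreal (integral {0..T} (\<lambda>u. poisson_weight (c * u) k))"
  using assms
  by (intro nn_integral_has_integral_lebesgue' integrable_integral integrable_continuous_real
        continuous_on_poisson_weight)
     (simp add: poisson_weight_def)

lemma integral_poisson_weight_pos:
  assumes "0 < c" "0 < T"
  shows "0 < integral {0..T} (\<lambda>u. poisson_weight (c * u) k)"
  using integral_less_real[of 0 T "\<lambda>_. 0" "\<lambda>u. poisson_weight (c * u) k"] assms
  by (simp add: continuous_on_poisson_weight) (simp add: poisson_weight_def)

text \<open>
  The inequality holds for the integrands at every \<open>0 < u < T\<close>: after cancelling common factors it reads
  \<open>(c u)\<^bsup>k - j\<^esup> < (c T)\<^bsup>k - j\<^esup>\<close>.
\<close>
lemma integral_poisson_weight_ratio:
  assumes "j < k" "0 < c" "0 < T"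
  shows "integral {0..T} (\<lambda>u. poisson_weight (c * u) k) * poisson_weight (c * T) j
       < integral {0..T} (\<lambda>u. poisson_weight (c * u) j) * poisson_weight (c * T) k"
proof -
  have "integral {0..T} (\<lambda>u. poisson_weight (c * u) k * poisson_weight (c * T) j)
      < integral {0..T} (\<lambda>u. poisson_weight (c * u) j * poisson_weight (c * T) k)"
  proof (rule integral_less_real)
    fix u assume u: "u \<in> {0<..<T}"
    obtain d where k: "k = j + d" "0 < d"
      using \<open>j < k\<close> less_imp_add_positive by blast
    have "(c * u) ^ d < (c * T) ^ d"
      using u assms k by (intro power_strict_mono) auto
    then show "poisson_weight (c * u) k * poisson_weight (c * T) j
        < poisson_weight (c * u) j * poisson_weight (c * T) k"
      using u assms unfolding poisson_weight_def k(1) power_add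
      by (simp add: divide_simps)
  qed (use assms in \<open>auto intro!: continuous_intros continuous_on_poisson_weight\<close>)
  then show ?thesis by simp
qed

section \<open>Arrival times and the counting process\<close>

text \<open>
  This presents the cycle length as the time integral of \<open>1\<close> over the cycle, so that it can be treated
  like the area under \<open>N\<close>.
\<close>
lemma emeasure_lborel_up_to:
  "emeasure lborel {u :: real. 0 \<le> u \<and> ennreal u \<le> t} = t"
proof (cases t)
  case (real r)
  then have "{u. 0 \<le> u \<and> ennreal u \<le> t} = {0..r}" by auto
  with real show ?thesis by simp
next
  case top
  then have "{u. 0 \<le> u \<and> ennreal u \<le> t} = {0..}" by auto
  moreover have "of_nat n \<le> emeasure lborel {0 :: real..}" for n
    using emeasure_mono[of "{0 .. real n}" "{0 :: real..}" lborel] by (simp add: ennreal_of_nat_eq_real_of_nat)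
  then have "emeasure lborel {0 :: real..} = top"
    using ennreal_Ex_less_of_nat[of "emeasure lborel {0 :: real..}"] leD
    by (metis infinity_ennreal_def less_top)
  ultimately show ?thesis
    using top by simp
qed

lemma arrival_time_le: "0 \<le> u \<Longrightarrow> n \<le> N u \<omega> \<Longrightarrow> arrival_time N n \<omega> \<le> ennreal u"
  unfolding arrival_time_def by (intro INF_lower) auto

context poisson_process
begin

lemma arrival_time_ge:
  assumes "\<omega> \<in> space M" "0 \<le> u" "N u \<omega> < n"
  shows "ennreal u \<le> arrival_time N n \<omega>"
  unfolding arrival_time_def
proof (rule INF_greatest)
  fix t assume "t \<in> {t. 0 \<le> t \<and> n \<le> N t \<omega>}"
  then show "ennreal u \<le> ennreal t"
    using assms count_mono[of \<omega> t u] by (cases "t \<le> u") (auto intro: ennreal_leI)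
qed

text \<open>
  The two conditions can differ only at the single time \<open>u\<close> at which the \<open>n\<close>-th order arrives.
\<close>
lemma AE_before_arrival_iff:
  assumes "\<omega> \<in> space M"
  shows "AE u in lborel. 0 \<le> u \<longrightarrow> (ennreal u \<le> arrival_time N n \<omega> \<longleftrightarrow> N u \<omega> < n)"
proof -
  have "AE u in lborel. u \<noteq> enn2real (arrival_time N n \<omega>)"
    by (rule AE_lborel_singleton)
  then show ?thesis
  proof eventually_elim
    case (elim u)
    then show ?case
      using arrival_time_le[of u n N \<omega>] arrival_time_ge[OF assms, of u n]
      by (metis enn2real_ennreal leI order.antisym)
  qed
qed

text \<open>
  Tonelli's theorem needs measurability in time and outcome together. By right-continuity and
  monotonicity, \<open>N u \<omega> < k\<close> holds iff \<open>N r \<omega> < k\<close> for some rational \<open>r > u\<close>, which writes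
  this event as a countable union of measurable rectangles. The maximum with \<open>0\<close> extends the
  process to negative times, where nothing is known about \<open>N\<close>.
\<close>
lemma measurable_count_joint:
  "(\<lambda>(u, \<omega>). N (max 0 u) \<omega>) \<in> lborel \<Otimes>\<^sub>M M \<rightarrow>\<^sub>M count_space UNIV"
proof -
  have less: "Measurable.pred (lborel \<Otimes>\<^sub>M M) (\<lambda>(u, \<omega>). N (max 0 u) \<omega> < k)" for k
  proof -
    have "{x \<in> space (lborel \<Otimes>\<^sub>M M). case x of (u, \<omega>) \<Rightarrow> N (max 0 u) \<omega> < k}
        = (\<Union>r\<in>\<rat>. {..<r} \<times> {\<omega> \<in> space M. N (max 0 r) \<omega> < k})" (is "?L = ?R")
    proof (intro set_eqI iffI)
      fix x assume "x \<in> ?L"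
      then obtain u \<omega> where x: "x = (u, \<omega>)" "\<omega> \<in> space M" "N (max 0 u) \<omega> < k"
        by (auto simp: space_pair_measure)
      have "((\<lambda>v. N v \<omega>) \<longlongrightarrow> N (max 0 u) \<omega>) (at_right (max 0 u))"
        using right_continuous[of \<omega> "max 0 u"] x by (simp add: continuous_within)
      then have "eventually (\<lambda>v. N v \<omega> = N (max 0 u) \<omega>) (at_right (max 0 u))"
        by (simp add: tendsto_discrete)
      then obtain b where b: "max 0 u < b" "\<And>v. max 0 u < v \<Longrightarrow> v < b \<Longrightarrow> N v \<omega> = N (max 0 u) \<omega>"
        by (auto simp: eventually_at_right_field)
      obtain r where "r \<in> \<rat>" "max 0 u < r" "r < b"
        using Rats_dense_in_real[OF b(1)] by auto
      then show "x \<in> ?R"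
        using x b(2)[of r] by (auto intro!: bexI[of _ r])
    next
      fix x assume "x \<in> ?R"
      then obtain u \<omega> r where x: "x = (u, \<omega>)" "\<omega> \<in> space M" "u < r" "N (max 0 r) \<omega> < k"
        by auto
      then have "N (max 0 u) \<omega> \<le> N (max 0 r) \<omega>"
        by (intro count_mono) auto
      with x show "x \<in> ?L"
        by (auto simp: space_pair_measure)
    qed
    moreover have "{..<r} \<times> {\<omega> \<in> space M. N (max 0 r) \<omega> < k} \<in> sets (lborel \<Otimes>\<^sub>M M)" for r
      using measurable_count[of "max 0 r"] by (intro pair_measureI) auto
    ultimately show ?thesis
      unfolding pred_def by (auto intro!: sets.countable_UN' countable_rat)
  qed
  have eq: "N (max 0 u) \<omega> = k \<longleftrightarrow> N (max 0 u) \<omega> < Suc k \<and> \<not> N (max 0 u) \<omega> < k" for u \<omega> k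
    by auto
  show ?thesis
    unfolding measurable_count_space_eq2_countable
  proof (intro conjI ballI)
    fix k :: nat
    have "Measurable.pred (lborel \<Otimes>\<^sub>M M) (\<lambda>(u, \<omega>). N (max 0 u) \<omega> < Suc k \<and> \<not> N (max 0 u) \<omega> < k)"
      using less[of k] less[of "Suc k"] by (simp add: split_beta')
    then show "(\<lambda>(u, \<omega>). N (max 0 u) \<omega>) -` {k} \<inter> space (lborel \<Otimes>\<^sub>M M) \<in> sets (lborel \<Otimes>\<^sub>M M)"
      unfolding eq[symmetric] by (simp add: pred_def split_beta' vimage_def Int_def conj_commute)
  qed auto
qed

lemma emeasure_count_eq:
  assumes "0 \<le> u"
  shows "emeasure M {\<omega> \<in> space M. N u \<omega> = k} = ennreal (poisson_weight (rate * u) k)"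
proof (cases "u = 0")
  case True
  then have "{\<omega> \<in> space M. N u \<omega> = k} = (if k = 0 then space M else {})"
    using count_zero by auto
  with True show ?thesis
    by (simp add: poisson_weight_def emeasure_space_1)
next
  case False
  with assms have "0 < u" by simp
  have m: "(\<lambda>\<omega>. N u \<omega> - N 0 \<omega>) \<in> M \<rightarrow>\<^sub>M count_space UNIV"
    using measurable_count[of u] measurable_count[of 0] assms by measurable
  have "emeasure M {\<omega> \<in> space M. N u \<omega> = k}
      = emeasure (distr M (count_space UNIV) (\<lambda>\<omega>. N u \<omega> - N 0 \<omega>)) {k}"
    by (subst emeasure_distr[OF m]) (auto intro!: arg_cong[where f = "emeasure M"] simp: count_zero)
  also have "\<dots> = ennreal (poisson_weight (rate * u) k)"
    using poisson_increments[of 0 u] \<open>0 < u\<close> rate_pos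
    by (simp add: emeasure_pmf_single poisson_weight_def)
  finally show ?thesis .
qed

section \<open>Expected time spent at each level\<close>

text \<open>
  With \<open>N(0) = 0\<close> the event prescribes the increments over \<open>[0, u - T]\<close> and \<open>[u - T, u]\<close>, which
  are independent.
\<close>
lemma emeasure_count_eq_and_empty_before:
  assumes "0 < T" "T < u"
  shows "emeasure M {\<omega> \<in> space M. N u \<omega> = k \<and> N (u - T) \<omega> = 0}
       = ennreal (exp (- rate * (u - T)) * poisson_weight (rate * T) k)"
proof -
  define t where "t = (\<lambda>i::nat. if i = 0 then 0 else if i = 1 then u - T else u)"
  define X where "X i \<omega> = N (t (Suc i)) \<omega> - N (t i) \<omega>" for i \<omega>
  define A where "A = (\<lambda>i::nat. if i = 0 then {0} else {k})"
  have indep: "indep_vars (\<lambda>_. count_space UNIV) X {..<2}"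
    unfolding X_def by (rule independent_increments) (use assms in \<open>auto simp: t_def less_2_cases_iff\<close>)
  have prob: "prob (X i -` A i \<inter> space M) = measure (measure_pmf (poisson_pmf (rate * (t (Suc i) - t i)))) (A i)"
    if "i < 2" for i
  proof -
    have "X i \<in> M \<rightarrow>\<^sub>M count_space UNIV"
      using indep that by (auto simp: indep_vars_def)
    then have "prob (X i -` A i \<inter> space M) = measure (distr M (count_space UNIV) (X i)) (A i)"
      by (simp add: measure_distr)
    also have "distr M (count_space UNIV) (X i) = measure_pmf (poisson_pmf (rate * (t (Suc i) - t i)))"
      unfolding X_def using that assms by (intro poisson_increments) (auto simp: t_def less_2_cases_iff)
    finally show ?thesis .
  qed
  have "{\<omega> \<in> space M. N u \<omega> = k \<and> N (u - T) \<omega> = 0} = (\<Inter>i\<in>{..<2}. X i -` A i \<inter> space M)"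
    by (auto simp: X_def A_def t_def count_zero numeral_2_eq_2 lessThan_Suc)
  then have "emeasure M {\<omega> \<in> space M. N u \<omega> = k \<and> N (u - T) \<omega> = 0}
      = ennreal (prob (\<Inter>i\<in>{..<2}. X i -` A i \<inter> space M))"
    by (simp add: emeasure_eq_measure)
  also have "prob (\<Inter>i\<in>{..<2}. X i -` A i \<inter> space M) = (\<Prod>i<2. prob (X i -` A i \<inter> space M))"
    by (rule indep_varsD_finite[OF indep]) (auto simp: lessThan_empty_iff)
  also have "\<dots> = exp (- rate * (u - T)) * poisson_weight (rate * T) k"
    using assms rate_pos prob[of 0] prob[of 1]
    by (simp add: numeral_2_eq_2 lessThan_Suc A_def t_def measure_pmf_single poisson_weight_def)
  finally show ?thesis .
qed

text \<open>
  The hypothesis on \<open>\<tau>\<close> trades the random upper limit of the time integral for an event at the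
  fixed time \<open>u\<close>. It is asked for almost every \<open>u\<close> because it fails at \<open>u = \<tau>\<close> when \<open>\<tau>\<close> is the
  arrival time of the \<open>q\<close>-th order.
  After that the integrand is a finite sum over the levels \<open>k < q\<close>, and Tonelli exchanges
  the integrals. Taking \<open>f k = k\<close> gives the expected total waiting time of a cycle, and \<open>f k = 1\<close> its
  expected length.
\<close>
lemma expected_occupation:
  fixes f :: "nat \<Rightarrow> ennreal"
  assumes C: "Measurable.pred (lborel \<Otimes>\<^sub>M M) (\<lambda>(u, \<omega>). C u \<omega>)"
    and alive: "\<And>\<omega>. \<omega> \<in> space M \<Longrightarrow>
      AE u in lborel. 0 \<le> u \<longrightarrow> (ennreal u \<le> \<tau> \<omega> \<longleftrightarrow> N u \<omega> < q \<and> C u \<omega>)"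
  shows "(\<integral>\<^sup>+\<omega>. (\<integral>\<^sup>+u\<in>{u. 0 \<le> u \<and> ennreal u \<le> \<tau> \<omega>}. f (N u \<omega>) \<partial>lborel) \<partial>M)
       = (\<Sum>k<q. f k * (\<integral>\<^sup>+u\<in>{0..}. emeasure M {\<omega> \<in> space M. N u \<omega> = k \<and> C u \<omega>} \<partial>lborel))"
proof -
  interpret L: pair_sigma_finite lborel M by unfold_locales
  note [measurable] = measurable_count_joint C
  define E where "E k = {(u, \<omega>) \<in> space (lborel \<Otimes>\<^sub>M M). 0 \<le> u \<and> N (max 0 u) \<omega> = k \<and> C u \<omega>}" for k
  have E [measurable]: "E k \<in> sets (lborel \<Otimes>\<^sub>M M)" for k
  proof -
    have "Measurable.pred (lborel \<Otimes>\<^sub>M M) (\<lambda>(u, \<omega>). N (max 0 u) \<omega> = k)"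
      using measurable_compose[OF measurable_count_joint, of "\<lambda>n. n = k" "count_space UNIV"]
      by (simp add: split_beta')
    with C have "Measurable.pred (lborel \<Otimes>\<^sub>M M) (\<lambda>x. 0 \<le> fst x \<and> (case x of (u, \<omega>) \<Rightarrow> N (max 0 u) \<omega> = k) \<and> (case x of (u, \<omega>) \<Rightarrow> C u \<omega>))"
      by measurable
    then show ?thesis
      by (simp add: E_def pred_def split_beta')
  qed
  have "(\<integral>\<^sup>+\<omega>. (\<integral>\<^sup>+u\<in>{u. 0 \<le> u \<and> ennreal u \<le> \<tau> \<omega>}. f (N u \<omega>) \<partial>lborel) \<partial>M)
      = (\<integral>\<^sup>+\<omega>. (\<integral>\<^sup>+u. (\<Sum>k<q. f k * indicator (E k) (u, \<omega>)) \<partial>lborel) \<partial>M)"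
  proof (rule nn_integral_cong, rule nn_integral_cong_AE)
    fix \<omega> assume \<omega>: "\<omega> \<in> space M"
    show "AE u in lborel. f (N u \<omega>) * indicator {u. 0 \<le> u \<and> ennreal u \<le> \<tau> \<omega>} u
        = (\<Sum>k<q. f k * indicator (E k) (u, \<omega>))"
      using alive[OF \<omega>]
    proof eventually_elim
      case (elim u)
      have "(\<Sum>k<q. f k * indicator (E k) (u, \<omega>))
          = (\<Sum>k<q. if k = N u \<omega> then f k * of_bool (0 \<le> u \<and> C u \<omega>) else 0)"
        using \<omega> by (intro sum.cong) (auto simp: E_def space_pair_measure indicator_def)
      then show ?case
        using elim by (auto simp: indicator_def)
    qed
  qed
  also have "\<dots> = (\<integral>\<^sup>+\<omega>. (\<Sum>k<q. f k * (\<integral>\<^sup>+u. indicator (E k) (u, \<omega>) \<partial>lborel)) \<partial>M)"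
    by (intro nn_integral_cong, subst nn_integral_sum) (auto simp: nn_integral_cmult)
  also have "\<dots> = (\<Sum>k<q. f k * (\<integral>\<^sup>+\<omega>. (\<integral>\<^sup>+u. indicator (E k) (u, \<omega>) \<partial>lborel) \<partial>M))"
    by (simp add: nn_integral_sum nn_integral_cmult)
  also have "\<dots> = (\<Sum>k<q. f k * (\<integral>\<^sup>+u. (\<integral>\<^sup>+\<omega>. indicator (E k) (u, \<omega>) \<partial>M) \<partial>lborel))"
    by (subst L.Fubini') (simp_all add: split_beta')
  also have "\<dots> = (\<Sum>k<q. f k * (\<integral>\<^sup>+u\<in>{0..}. emeasure M {\<omega> \<in> space M. N u \<omega> = k \<and> C u \<omega>} \<partial>lborel))"
  proof (intro sum.cong refl arg_cong2[where f = "(*)"] nn_integral_cong)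
    fix k u
    have "(\<integral>\<^sup>+\<omega>. indicator (E k) (u, \<omega>) \<partial>M) = (\<integral>\<^sup>+\<omega>. indicator (Pair u -` E k) \<omega> \<partial>M)"
      by (simp add: indicator_def)
    also have "\<dots> = emeasure M (Pair u -` E k)"
      by (rule nn_integral_indicator) (rule sets_Pair1[OF E])
    also have "Pair u -` E k = (if 0 \<le> u then {\<omega> \<in> space M. N u \<omega> = k \<and> C u \<omega>} else {})"
      by (auto simp: E_def space_pair_measure)
    finally show "(\<integral>\<^sup>+\<omega>. indicator (E k) (u, \<omega>) \<partial>M)
        = emeasure M {\<omega> \<in> space M. N u \<omega> = k \<and> C u \<omega>} * indicator {0..} u"
      by (auto simp: indicator_def)
  qed
  finally show ?thesis .
qed

lemma average_order_delay_eq: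
  assumes C: "Measurable.pred (lborel \<Otimes>\<^sub>M M) (\<lambda>(u, \<omega>). C u \<omega>)"
    and alive: "\<And>\<omega>. \<omega> \<in> space M \<Longrightarrow>
      AE u in lborel. 0 \<le> u \<longrightarrow> (ennreal u \<le> \<tau> \<omega> \<longleftrightarrow> N u \<omega> < q \<and> C u \<omega>)"
    and levels: "\<And>k. (\<integral>\<^sup>+u\<in>{0..}. emeasure M {\<omega> \<in> space M. N u \<omega> = k \<and> C u \<omega>} \<partial>lborel) = ennreal (c k)"
    and pos: "\<And>k. 0 < c k" and "0 < q"
  shows "average_order_delay M N rate \<tau>
       = ennreal ((\<Sum>k<q. real k * c k) / (\<Sum>k<q. c k) / rate)"
proof -
  have num: "(\<integral>\<^sup>+\<omega>. (\<integral>\<^sup>+u\<in>{u. 0 \<le> u \<and> ennreal u \<le> \<tau> \<omega>}. of_nat (N u \<omega>) \<partial>lborel) \<partial>M)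
      = ennreal (\<Sum>k<q. real k * c k)"
    using expected_occupation[OF C alive, of of_nat] pos
    by (simp add: levels ennreal_of_nat_eq_real_of_nat less_imp_le flip: ennreal_mult)
  have "(\<integral>\<^sup>+\<omega>. \<tau> \<omega> \<partial>M)
      = (\<integral>\<^sup>+\<omega>. (\<integral>\<^sup>+u\<in>{u. 0 \<le> u \<and> ennreal u \<le> \<tau> \<omega>}. 1 \<partial>lborel) \<partial>M)"
    by (simp add: emeasure_lborel_up_to)
  also have "\<dots> = ennreal (\<Sum>k<q. c k)"
    using expected_occupation[OF C alive, of "\<lambda>_. 1"] pos by (simp add: levels less_imp_le)
  finally have den: "(\<integral>\<^sup>+\<omega>. \<tau> \<omega> \<partial>M) = ennreal (\<Sum>k<q. c k)" .
  have "0 < (\<Sum>k<q. c k)"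
    using pos \<open>0 < q\<close> by (intro sum_pos) (auto simp: lessThan_empty_iff)
  moreover have "0 \<le> (\<Sum>k<q. real k * c k)"
    using pos by (intro sum_nonneg) (simp add: less_imp_le)
  ultimately show ?thesis
    unfolding average_order_delay_def num den using rate_pos
    by (simp add: divide_ennreal mult.commute flip: ennreal_mult)
qed

section \<open>The two clearing policies\<close>

lemma HP1_alive_iff:
  assumes "\<omega> \<in> space M" "0 < T"
  shows "AE u in lborel. 0 \<le> u \<longrightarrow> (ennreal u \<le> HP1 N q T \<omega> \<longleftrightarrow> N u \<omega> < q \<and> u \<le> T)"
  using AE_before_arrival_iff[OF assms(1), of q]
  by eventually_elim (use assms in \<open>auto simp: HP1_def\<close>)

text \<open>
  For \<open>u > T\<close> the condition \<open>u \<le> \<tau>\<^sub>1 + T\<close> says that the first order does not arrive before \<open>u - T\<close>,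
  which up to the single time \<open>u = \<tau>\<^sub>1 + T\<close> means \<open>N(u - T) = 0\<close>. For \<open>u \<le> T\<close> both conditions hold,
  because \<open>N(0) = 0\<close>.
\<close>
lemma HP2_alive_iff:
  assumes "\<omega> \<in> space M" "0 < T"
  shows "AE u in lborel. 0 \<le> u \<longrightarrow>
    (ennreal u \<le> HP2 N q T \<omega> \<longleftrightarrow> N u \<omega> < q \<and> N (max 0 (u - T)) \<omega> = 0)"
proof -
  have "AE u in lborel. u \<noteq> enn2real (arrival_time N 1 \<omega>) + T"
    by (rule AE_lborel_singleton)
  then show ?thesis
    using AE_before_arrival_iff[OF assms(1), of q]
  proof eventually_elim
    case (elim u)
    have "ennreal u \<le> arrival_time N 1 \<omega> + ennreal T \<longleftrightarrow> N (max 0 (u - T)) \<omega> = 0" if "0 \<le> u"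
    proof (cases "u \<le> T")
      case True
      then have "ennreal u \<le> arrival_time N 1 \<omega> + ennreal T"
        by (metis add.commute add_increasing2 ennreal_leI zero_le)
      with True show ?thesis
        using assms count_zero by simp
    next
      case False
      then have "ennreal u = ennreal (u - T) + ennreal T"
        using assms by (simp flip: ennreal_plus)
      then have "ennreal u \<le> arrival_time N 1 \<omega> + ennreal T \<longleftrightarrow> ennreal (u - T) \<le> arrival_time N 1 \<omega>"
        by simp
      also have "\<dots> \<longleftrightarrow> N (u - T) \<omega> = 0"
      proof
        assume le: "ennreal (u - T) \<le> arrival_time N 1 \<omega>"
        show "N (u - T) \<omega> = 0"
        proof (rule ccontr)
          assume "N (u - T) \<omega> \<noteq> 0"
          then have "arrival_time N 1 \<omega> = ennreal (u - T)"
            using le False arrival_time_le[of "u - T" 1 N \<omega>] by auto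
          then show False
            using elim False by simp
        qed
      next
        assume "N (u - T) \<omega> = 0"
        then show "ennreal (u - T) \<le> arrival_time N 1 \<omega>"
          using False assms arrival_time_ge[of \<omega> "u - T" 1] by simp
      qed
      finally show ?thesis
        using False by simp
    qed
    then show ?case
      using elim by (auto simp: HP2_def)
  qed
qed

lemma HP1_levels:
  assumes "0 < T"
  shows "(\<integral>\<^sup>+u\<in>{0..}. emeasure M {\<omega> \<in> space M. N u \<omega> = k \<and> u \<le> T} \<partial>lborel)
       = ennreal (integral {0..T} (\<lambda>u. poisson_weight (rate * u) k))"
proof -
  have "(\<integral>\<^sup>+u\<in>{0..}. emeasure M {\<omega> \<in> space M. N u \<omega> = k \<and> u \<le> T} \<partial>lborel)
      = (\<integral>\<^sup>+u\<in>{0..T}. ennreal (poisson_weight (rate * u) k) \<partial>lborel)"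
    by (intro nn_integral_cong) (auto simp: indicator_def emeasure_count_eq)
  also have "\<dots> = ennreal (integral {0..T} (\<lambda>u. poisson_weight (rate * u) k))"
    using rate_pos by (simp add: nn_integral_poisson_weight)
  finally show ?thesis .
qed

text \<open>
  For \<open>k < q\<close> this is the expected time of HP2 at level \<open>k\<close>. The first summand is the time spent before
  \<open>T\<close>. At a time \<open>u > T\<close> the cycle is still running at level \<open>k\<close> with probability \<open>exp (- rate * (u - T))\<close> times the Poisson weight of \<open>k\<close> on a window of length
  \<open>T\<close>, and integrating the exponential over \<open>u\<close> gives the factor \<open>1 / rate\<close>.
\<close>
lemma HP2_levels:
  assumes "0 < T"
  shows "(\<integral>\<^sup>+u\<in>{0..}. emeasure M {\<omega> \<in> space M. N u \<omega> = k \<and> N (max 0 (u - T)) \<omega> = 0} \<partial>lborel)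
       = ennreal (integral {0..T} (\<lambda>u. poisson_weight (rate * u) k) + poisson_weight (rate * T) k / rate)"
proof -
  let ?w = "poisson_weight (rate * T) k"
  have w: "0 \<le> ?w"
    using rate_pos assms by (simp add: poisson_weight_def)
  have "(\<integral>\<^sup>+u\<in>{0..}. emeasure M {\<omega> \<in> space M. N u \<omega> = k \<and> N (max 0 (u - T)) \<omega> = 0} \<partial>lborel)
      = (\<integral>\<^sup>+u. ennreal (poisson_weight (rate * u) k) * indicator {0..T} u
               + ennreal (exp (- rate * (u - T)) * ?w) * indicator {T..} u \<partial>lborel)"
  proof (rule nn_integral_cong_AE)
    show "AE u in lborel. emeasure M {\<omega> \<in> space M. N u \<omega> = k \<and> N (max 0 (u - T)) \<omega> = 0} * indicator {0..} u
        = ennreal (poisson_weight (rate * u) k) * indicator {0..T} u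
          + ennreal (exp (- rate * (u - T)) * ?w) * indicator {T..} u"
      using AE_lborel_singleton[of T]
    proof eventually_elim
      case (elim u)
      consider "u < 0" | "0 \<le> u" "u < T" | "T < u"
        using elim by linarith
      then show ?case
      proof cases
        case 2
        then have "{\<omega> \<in> space M. N u \<omega> = k \<and> N (max 0 (u - T)) \<omega> = 0} = {\<omega> \<in> space M. N u \<omega> = k}"
          using count_zero by auto
        with 2 show ?thesis
          by (simp add: emeasure_count_eq)
      next
        case 3
        then show ?thesis
          using assms emeasure_count_eq_and_empty_before[of T u k] by simp
      qed (use assms in simp)
    qed
  qed
  also have "\<dots> = (\<integral>\<^sup>+u\<in>{0..T}. ennreal (poisson_weight (rate * u) k) \<partial>lborel)
               + (\<integral>\<^sup>+u\<in>{T..}. ennreal (exp (- rate * (u - T)) * ?w) \<partial>lborel)"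
    by (rule nn_integral_add) (simp_all add: poisson_weight_def)
  also have "(\<integral>\<^sup>+u\<in>{0..T}. ennreal (poisson_weight (rate * u) k) \<partial>lborel)
      = ennreal (integral {0..T} (\<lambda>u. poisson_weight (rate * u) k))"
    using rate_pos by (simp add: nn_integral_poisson_weight)
  also have "(\<integral>\<^sup>+u\<in>{T..}. ennreal (exp (- rate * (u - T)) * ?w) \<partial>lborel)
      = ennreal (0 - (- exp (- rate * (T - T)) * ?w / rate))"
  proof (rule nn_integral_FTC_atLeast[where F = "\<lambda>u. - exp (- rate * (u - T)) * ?w / rate"])
    show "((\<lambda>u. - exp (- rate * (u - T)) * ?w / rate) has_real_derivative exp (- rate * (u - T)) * ?w) (at u)" for u
      using rate_pos by (auto intro!: derivative_eq_intros)
    show "((\<lambda>u. - exp (- rate * (u - T)) * ?w / rate) \<longlongrightarrow> 0) at_top"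
    proof -
      have "filterlim (\<lambda>u. - T + u) at_top at_top"
        by (rule filterlim_tendsto_add_at_top[OF tendsto_const filterlim_ident])
      then have "filterlim (\<lambda>u. - rate * (- T + u)) at_bot at_top"
        using rate_pos by (intro filterlim_tendsto_neg_mult_at_bot[OF tendsto_const]) auto
      then have "((\<lambda>u. exp (- rate * (- T + u))) \<longlongrightarrow> 0) at_top"
        by (rule filterlim_compose[OF exp_at_bot])
      then show ?thesis
        using tendsto_mult[OF _ tendsto_const[of "- ?w / rate"]] by (fastforce simp: algebra_simps)
    qed
  qed (use w in simp_all)
  finally show ?thesis
    using w rate_pos integral_poisson_weight_pos[OF rate_pos assms, of k] by simp
qed

end

theorem theorem6p3:
  fixes M :: "'a measure" and N :: "real \<Rightarrow> 'a \<Rightarrow> nat" and rate T :: real and q :: nat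
  assumes "poisson_process M N rate"
    and "2 \<le> q"
    and "0 < T"
  shows "average_order_delay M N rate (HP1 N q T) < average_order_delay M N rate (HP2 N q T)"
proof -
  interpret poisson_process M N rate by fact
  \<comment> \<open>\<open>a k\<close> is the expected time of HP1 at level \<open>k < q\<close>; \<open>b k\<close> is what HP2 adds to it.\<close>
  define a where "a k = integral {0..T} (\<lambda>u. poisson_weight (rate * u) k)" for k
  define b where "b k = poisson_weight (rate * T) k / rate" for k
  have a: "0 < a k" for k
    unfolding a_def using integral_poisson_weight_pos rate_pos assms by blast
  have b: "0 < b k" for k
    using rate_pos assms by (simp add: b_def poisson_weight_def)
  have mlr: "a k * b j < a j * b k" if "j < k" for j k
    using integral_poisson_weight_ratio[OF that rate_pos \<open>0 < T\<close>] rate_pos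
    by (simp add: a_def b_def divide_strict_right_mono)
  have less: "(\<Sum>k<q. real k * a k) / (\<Sum>k<q. a k)
      < (\<Sum>k<q. real k * (a k + b k)) / (\<Sum>k<q. a k + b k)"
    by (rule ratio_mean_less[OF \<open>2 \<le> q\<close> a b mlr])
  have "average_order_delay M N rate (HP1 N q T)
      = ennreal ((\<Sum>k<q. real k * a k) / (\<Sum>k<q. a k) / rate)"
    using HP1_alive_iff HP1_levels assms a
    by (intro average_order_delay_eq[where C = "\<lambda>u \<omega>. u \<le> T"]) (auto simp: a_def split_beta')
  moreover have "average_order_delay M N rate (HP2 N q T)
      = ennreal ((\<Sum>k<q. real k * (a k + b k)) / (\<Sum>k<q. a k + b k) / rate)"
  proof (rule average_order_delay_eq)
    have "(\<lambda>(u, \<omega>). N (max 0 (u - T)) \<omega>) \<in> lborel \<Otimes>\<^sub>M M \<rightarrow>\<^sub>M count_space UNIV"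
      using measurable_compose[OF _ measurable_count_joint, of "\<lambda>(u, \<omega>). (u - T, \<omega>)" "lborel \<Otimes>\<^sub>M M"]
      by (simp add: split_beta')
    then show "Measurable.pred (lborel \<Otimes>\<^sub>M M) (\<lambda>(u, \<omega>). N (max 0 (u - T)) \<omega> = 0)"
      by (simp add: split_beta')
  qed (use HP2_alive_iff HP2_levels assms a b in \<open>auto simp: a_def b_def add_pos_pos\<close>)
  moreover have "0 \<le> (\<Sum>k<q. real k * a k) / (\<Sum>k<q. a k) / rate"
    using a rate_pos by (simp add: sum_nonneg less_imp_le)
  ultimately show ?thesis
    using divide_strict_right_mono[OF less rate_pos]
    by (simp add: ennreal_less_iff del: divide_divide_eq_left)
qed

end
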